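(* Let $n,m$ be positive integers with $m\mid n$, $b=n/m$, $A\in\mathbb{R}^{n\times n}$ symmetric positive semidefinite, $G\in\mathbb{R}^{n\times m}$, $\eta>0$. Consider $$(P)\quad \min_{X\in\mathcal X\cap\mathcal Y}\ \tfrac12\langle A,XX^\top\rangle+\langle G,X\rangle+\eta\sum_{i,j}|X_{ij}|^{1/2},$$ $$(P')\quad \min_{X\in\mathcal X,\,Y\in\mathcal Y,\,Y-X=0}\ \tfrac12\langle A,XY^\top\rangle+\langle G,Y\rangle+\eta\sum_{i,j}|X_{ij}|^{1/2},$$ where $\mathcal X=\{X\in\mathbb{R}^{n\times m}:0\le X_{ij}\le1\}$ and $\mathcal Y=\{Y\in\mathbb{R}^{n\times m}:\mathbf 1_n^\top Y=b\mathbf 1_m^\top,\ Y\mathbf 1_m=\mathbf 1_n\}$. Then the KKT points of $(P)$ and $(P')$ are equivalent: $X^*$ is a KKT point of $(P)$ if and only if $X^*$ is a KKT point of $(P')$.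
   Context: $\mathbf 1_k\in\mathbb{R}^k$ is the all-ones vector, $\langle\cdot,\cdot\rangle$ the Frobenius inner product. $\partial|x|^{1/2}=\{\tfrac12x^{-1/2}\}$ for $x>0$ and $\partial|x|^{1/2}=\mathbb{R}$ for $x=0$. $M\in N_{\mathcal X}(X)$ (for $X\in\mathcal X$) iff for every $i,j$: $M_{ij}=0$ if $X_{ij}\in(0,1)$, $M_{ij}\ge0$ if $X_{ij}=1$, $M_{ij}\le0$ if $X_{ij}=0$. $N_{\mathcal Y}(Y)=\{\nu\mathbf 1_m^\top+\mathbf 1_n\mu^\top:\nu\in\mathbb{R}^n,\mu\in\mathbb{R}^m\}$ for $Y\in\mathcal Y$. $X^*$ is a KKT point of $(P)$ if $X^*\in\mathcal X\cap\mathcal Y$ and there are $M^*\in N_{\mathcal X}(X^* )$, $Z^*\in N_{\mathcal Y}(X^* )$ with $0\in (AX^* )_{ij}+G_{ij}+\eta\,\partial|X^*_{ij}|^{1/2}+M^*_{ij}+Z^*_{ij}$ for all $i,j$. $X^*$ is a KKT point of $(P')$ if $X^*\in\mathcal X$ and there are $Y^*\in\mathcal Y$, $\Lambda^*\in\mathbb{R}^{n\times m}$, $M^*\in N_{\mathcal X}(X^* )$, $Z^*\in N_{\mathcal Y}(Y^* )$ such that $Y^*-X^*=0$ and, for all $i,j$, $0\in-\Lambda^*_{ij}+\tfrac12(AY^* )_{ij}+\eta\,\partial|X^*_{ij}|^{1/2}+M^*_{ij}$ and $0=\Lambda^*_{ij}+\tfrac12(AX^* )_{ij}+G_{ij}+Z^*_{ij}$.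 *)

theory Defs
  imports "HOL-Analysis.Analysis"
begin

text \<open>
  An \<open>n \<times> m\<close> matrix is an element of \<^typ>\<open>real ^ 'm ^ 'n\<close>, with \<open>n = CARD('n)\<close> rows and
  \<open>m = CARD('m)\<close> columns.  The constant \<^term>\<open>1 :: real ^ 'k\<close> is the all-ones vector.

  The two problems, for data \<open>A\<close>, \<open>G\<close>, \<open>\<eta>\<close>, are

  \<^item> (P) minimise \<open>1/2 \<langle>A, X X\<^sup>T\<rangle> + \<langle>G, X\<rangle> + \<eta> (\<Sum>i j. \<bar>X i j\<bar> powr (1/2))\<close>
    over \<open>X \<in> box_set \<inter> assign_set\<close>;
  \<^item> (P') minimise \<open>1/2 \<langle>A, X Y\<^sup>T\<rangle> + \<langle>G, Y\<rangle> + \<eta> (\<Sum>i j. \<bar>X i j\<bar> powr (1/2))\<close>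
    over \<open>X \<in> box_set\<close>, \<open>Y \<in> assign_set\<close> with \<open>Y - X = 0\<close>.
\<close>

definition positive_semidefinite :: "real ^ 'n ^ 'n \<Rightarrow> bool" where
  "positive_semidefinite A \<longleftrightarrow> (\<forall>x. 0 \<le> x \<bullet> (A *v x))"

definition box_set :: "(real ^ 'm ^ 'n) set" where
  "box_set = {X. \<forall>i j. 0 \<le> X $ i $ j \<and> X $ i $ j \<le> 1}"

text \<open>Column sums \<open>b = n/m\<close> and row sums \<open>1\<close>.\<close>

definition assign_set :: "(real ^ 'm ^ 'n) set" where
  "assign_set = {Y. 1 v* Y = (real CARD('n) / real CARD('m)) *\<^sub>R (1 :: real ^ 'm)
                  \<and> Y *v 1 = (1 :: real ^ 'n)}"

text \<open>
  The subdifferential of \<open>x \<mapsto> \<bar>x\<bar> powr (1/2)\<close>.  Only \<open>x \<ge> 0\<close> is relevant on \<^const>\<open>box_set\<close>; the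
  value at \<open>x < 0\<close> is the ordinary derivative.
\<close>

definition subdiff_sqrt_abs :: "real \<Rightarrow> real set" where
  "subdiff_sqrt_abs x =
     (if x = 0 then UNIV
      else if x > 0 then {1/2 * x powr (-1/2)}
      else {- (1/2) * (- x) powr (-1/2)})"

text \<open>As usual, normal cones are empty at points outside the set.\<close>

definition normal_cone_box :: "real ^ 'm ^ 'n \<Rightarrow> (real ^ 'm ^ 'n) set" where
  "normal_cone_box X =
     {M. X \<in> box_set \<and>
         (\<forall>i j. (0 < X $ i $ j \<and> X $ i $ j < 1 \<longrightarrow> M $ i $ j = 0) \<and>
                (X $ i $ j = 1 \<longrightarrow> M $ i $ j \<ge> 0) \<and>
                (X $ i $ j = 0 \<longrightarrow> M $ i $ j \<le> 0))}"

text \<open>Entry \<open>(i, j)\<close> of \<open>\<nu> 1\<^sup>T + 1 \<mu>\<^sup>T\<close> is \<open>\<nu> i + \<mu> j\<close>.\<close>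

definition normal_cone_assign :: "real ^ 'm ^ 'n \<Rightarrow> (real ^ 'm ^ 'n) set" where
  "normal_cone_assign Y =
     {Z. Y \<in> assign_set \<and>
         (\<exists>(\<nu> :: real ^ 'n) (\<mu> :: real ^ 'm). Z = (\<chi> i j. \<nu> $ i + \<mu> $ j))}"

definition KKT_P :: "real ^ 'n ^ 'n \<Rightarrow> real ^ 'm ^ 'n \<Rightarrow> real \<Rightarrow> real ^ 'm ^ 'n \<Rightarrow> bool" where
  "KKT_P A G \<eta> X \<longleftrightarrow>
     X \<in> box_set \<inter> assign_set \<and>
     (\<exists>M \<in> normal_cone_box X. \<exists>Z \<in> normal_cone_assign X. \<forall>i j.
        0 \<in> (\<lambda>s. (A ** X) $ i $ j + G $ i $ j + \<eta> * s + M $ i $ j + Z $ i $ j)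
              ` subdiff_sqrt_abs (X $ i $ j))"

definition KKT_P' :: "real ^ 'n ^ 'n \<Rightarrow> real ^ 'm ^ 'n \<Rightarrow> real \<Rightarrow> real ^ 'm ^ 'n \<Rightarrow> bool" where
  "KKT_P' A G \<eta> X \<longleftrightarrow>
     X \<in> box_set \<and>
     (\<exists>Y \<in> assign_set. \<exists>\<Lambda> :: real ^ 'm ^ 'n.
      \<exists>M \<in> normal_cone_box X. \<exists>Z \<in> normal_cone_assign Y.
        Y - X = 0 \<and>
        (\<forall>i j.
          0 \<in> (\<lambda>s. - \<Lambda> $ i $ j + 1/2 * (A ** Y) $ i $ j + \<eta> * s + M $ i $ j)
                ` subdiff_sqrt_abs (X $ i $ j) \<and>
          0 = \<Lambda> $ i $ j + 1/2 * (A ** X) $ i $ j + G $ i $ j + Z $ i $ j))"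

end

theory Submission
  imports Defs
begin

text \<open>The constraint \<open>Y - X = 0\<close> splits the gradient \<open>A ** X\<close> of the
  quadratic term into two halves, one in each stationarity condition of (P'). Adding these
  conditions cancels the multiplier \<Lambda> and leaves the condition of (P). Conversely, \<Lambda>
  is unconstrained, so it can be chosen to solve the equation in \<open>Y\<close>; the inclusion in
  \<open>X\<close> then becomes that of (P). The same \<open>M\<close> and \<open>Z\<close> serve
  both problems.\<close>

theorem proposition4p1:
  fixes A :: "real ^ 'n ^ 'n" and G :: "real ^ 'm ^ 'n" and \<eta> :: real
    and X :: "real ^ 'm ^ 'n"
  assumes "CARD('m) dvd CARD('n)"
    and "transpose A = A"
    and "positive_semidefinite A"
    and "\<eta> > 0"
  shows "KKT_P A G \<eta> X \<longleftrightarrow> KKT_P' A G \<eta> X"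
proof
  assume "KKT_P A G \<eta> X"
  then obtain M Z where X: "X \<in> box_set" "X \<in> assign_set"
    and M: "M \<in> normal_cone_box X" and Z: "Z \<in> normal_cone_assign X"
    and st: "\<And>i j. 0 \<in> (\<lambda>s. (A ** X) $ i $ j + G $ i $ j + \<eta> * s + M $ i $ j + Z $ i $ j)
                       ` subdiff_sqrt_abs (X $ i $ j)"
    unfolding KKT_P_def by blast
  \<comment> \<open>Stationarity in \<open>Y\<close> determines the multiplier.\<close>
  define \<Lambda> :: "real ^ 'm ^ 'n"
    where "\<Lambda> = (\<chi> i j. - (1/2 * (A ** X) $ i $ j + G $ i $ j + Z $ i $ j))"
  \<comment> \<open>Here -\<Lambda> supplies the missing half of \<open>A ** X\<close> together with
    \<open>G\<close> and \<open>Z\<close>. Equality as functions of \<open>s\<close> keeps the same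
    subgradient as witness.\<close>
  have "(\<lambda>s. - \<Lambda> $ i $ j + 1/2 * (A ** X) $ i $ j + \<eta> * s + M $ i $ j)
      = (\<lambda>s. (A ** X) $ i $ j + G $ i $ j + \<eta> * s + M $ i $ j + Z $ i $ j)" for i j
    by (simp add: \<Lambda>_def fun_eq_iff)
  moreover have "0 = \<Lambda> $ i $ j + 1/2 * (A ** X) $ i $ j + G $ i $ j + Z $ i $ j" for i j
    by (simp add: \<Lambda>_def)
  ultimately have "\<forall>i j.
      0 \<in> (\<lambda>s. - \<Lambda> $ i $ j + 1/2 * (A ** X) $ i $ j + \<eta> * s + M $ i $ j)
            ` subdiff_sqrt_abs (X $ i $ j) \<and>
      0 = \<Lambda> $ i $ j + 1/2 * (A ** X) $ i $ j + G $ i $ j + Z $ i $ j"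
    using st by presburger
  then show "KKT_P' A G \<eta> X"
    unfolding KKT_P'_def using X M Z diff_self[of X] by blast
next
  assume "KKT_P' A G \<eta> X"
  then obtain Y \<Lambda> M Z where X: "X \<in> box_set" and Y: "Y \<in> assign_set"
    and M: "M \<in> normal_cone_box X" and Z: "Z \<in> normal_cone_assign Y" and YX: "Y - X = 0"
    and stX: "\<And>i j. 0 \<in> (\<lambda>s. - \<Lambda> $ i $ j + 1/2 * (A ** Y) $ i $ j + \<eta> * s + M $ i $ j)
                        ` subdiff_sqrt_abs (X $ i $ j)"
    and stY: "\<And>i j. 0 = \<Lambda> $ i $ j + 1/2 * (A ** X) $ i $ j + G $ i $ j + Z $ i $ j"
    unfolding KKT_P'_def by blast
  \<comment> \<open>This merges the halves \<open>A ** Y\<close> and \<open>A ** X\<close>, and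
    makes \<open>Z\<close> normal at \<open>X\<close>.\<close>
  from YX have [simp]: "Y = X" by simp
  \<comment> \<open>Elimination of \<Lambda>: \<open>stY\<close> gives -\<Lambda> entrywise as half
    of \<open>A ** X\<close> plus \<open>G\<close> plus \<open>Z\<close>.\<close>
  have "(\<lambda>s. (A ** X) $ i $ j + G $ i $ j + \<eta> * s + M $ i $ j + Z $ i $ j)
      = (\<lambda>s. - \<Lambda> $ i $ j + 1/2 * (A ** Y) $ i $ j + \<eta> * s + M $ i $ j)" for i j
    using stY[of i j] by (simp add: fun_eq_iff)
  then have "\<forall>i j. 0 \<in> (\<lambda>s. (A ** X) $ i $ j + G $ i $ j + \<eta> * s + M $ i $ j + Z $ i $ j)
                        ` subdiff_sqrt_abs (X $ i $ j)"
    using stX by presburger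
  then show "KKT_P A G \<eta> X"
    unfolding KKT_P_def using X Y M Z \<open>Y = X\<close> by blast
qed

end
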